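(* Let $p$ be a prime number and $n\geq 1$ a natural number. Then, up to graph isomorphism, $$Cl_2(\mathbb{Z}_{p^n})=\begin{cases}K_1, & \text{if } p=2,\ n=1,\\ 2K_1, & \text{if } p=2,\ n=2,\\ 4K_1\cup\left(2^{n-1}-2^{n-2}-2\right)K_2, & \text{if } p=2,\ n\geq 3,\\ 2K_1\cup\left(\frac{p^n-p^{n-1}}{2}-1\right)K_2, & \text{if } p\neq 2,\ n\geq 1.\end{cases}$$
   Context: $\mathbb{Z}_m$ is the ring of integers modulo $m$. For a ring $R$ with identity, $Id(R)$ is the set of idempotents and $U(R)$ the set of units. $Cl_2(R)$ is the simple undirected graph with vertex set $\{(e,u): e\in Id(R)\setminus\{0\},\ u\in U(R)\}$, in which two distinct vertices $(e,u)$ and $(f,v)$ are adjacent if and only if $ef=fe=0$ or $uv=vu=1$. $K_r$ is the complete graph on $r$ vertices, $\cup$ denotes disjoint union of graphs, and $rG$ denotes the disjoint union of $r$ copies of $G$ ($0G$ being the graph with no vertices). *)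

theory Defs
  imports
    "HOL-Number_Theory.Residues"
    "Graph_Theory.Pair_Digraph"
    "Graph_Theory.Digraph_Isomorphism"
    "Graph_Theory.Kuratowski"
begin

text \<open>
  Following the convention of the session Graph_Theory, a simple undirected graph is a symmetric
  loopfree digraph without parallel arcs, i.e. an instance of the locale \<^locale>\<open>pair_graph\<close> when
  it is finite: every undirected edge is represented by its two orientations.
\<close>

definition idempotents :: "('a, 'm) ring_scheme \<Rightarrow> 'a set" where
  "idempotents R = {e \<in> carrier R. e \<otimes>\<^bsub>R\<^esub> e = e}"

definition clean_graph2 :: "('a, 'm) ring_scheme \<Rightarrow> ('a \<times> 'a) pair_pre_digraph" where
  "clean_graph2 R =
    (let V = (idempotents R - {\<zero>\<^bsub>R\<^esub>}) \<times> Units R in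
      \<lparr>pverts = V,
       parcs = {((e, u), (f, v)) | e u f v. (e, u) \<in> V \<and> (f, v) \<in> V \<and> (e, u) \<noteq> (f, v) \<and>
         ((e \<otimes>\<^bsub>R\<^esub> f = \<zero>\<^bsub>R\<^esub> \<and> f \<otimes>\<^bsub>R\<^esub> e = \<zero>\<^bsub>R\<^esub>) \<or> (u \<otimes>\<^bsub>R\<^esub> v = \<one>\<^bsub>R\<^esub> \<and> v \<otimes>\<^bsub>R\<^esub> u = \<one>\<^bsub>R\<^esub>))}\<rparr>)"

definition complete_graph :: "nat \<Rightarrow> nat pair_pre_digraph" where
  "complete_graph r = \<lparr>pverts = {..<r}, parcs = {(i, j). i < r \<and> j < r \<and> i \<noteq> j}\<rparr>"

definition graph_union :: "'a pair_pre_digraph \<Rightarrow> 'b pair_pre_digraph \<Rightarrow> ('a + 'b) pair_pre_digraph"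
  where
  "graph_union G H =
    \<lparr>pverts = pverts G <+> pverts H,
     parcs = {(Inl x, Inl y) | x y. (x, y) \<in> parcs G} \<union> {(Inr x, Inr y) | x y. (x, y) \<in> parcs H}\<rparr>"

definition graph_copies :: "nat \<Rightarrow> 'a pair_pre_digraph \<Rightarrow> (nat \<times> 'a) pair_pre_digraph" where
  "graph_copies r G =
    \<lparr>pverts = {..<r} \<times> pverts G,
     parcs = {((i, x), (i, y)) | i x y. i < r \<and> (x, y) \<in> parcs G}\<rparr>"

definition graph_isomorphic :: "'a pair_pre_digraph \<Rightarrow> 'b pair_pre_digraph \<Rightarrow> bool" where
  "graph_isomorphic G H \<longleftrightarrow> digraph_iso (with_proj G) (with_proj H)"

lemma pair_graph_clean_graph2:
  assumes "finite (carrier R)"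
  shows "pair_graph (clean_graph2 R)"
proof -
  let ?V = "(idempotents R - {\<zero>\<^bsub>R\<^esub>}) \<times> Units R"
  have "?V \<subseteq> carrier R \<times> carrier R"
    by (auto simp: idempotents_def Units_def)
  then have V: "finite ?V"
    using assms by (meson finite_SigmaI finite_subset)
  have "parcs (clean_graph2 R) \<subseteq> ?V \<times> ?V"
    by (auto simp: clean_graph2_def)
  then have A: "finite (parcs (clean_graph2 R))"
    using V by (meson finite_SigmaI finite_subset)
  show ?thesis
    using V A
    by unfold_locales (auto simp: clean_graph2_def symmetric_def intro!: symI)
qed

lemma complete_digraph_complete_graph: "complete_digraph r (with_proj (complete_graph r))"
  by (auto simp: complete_digraph_pair_def complete_graph_def)

lemma pair_graph_complete_graph: "pair_graph (complete_graph r)"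
  by (rule pair_graphI_complete[OF complete_digraph_complete_graph])

lemma pair_graph_graph_union:
  assumes "pair_graph G" "pair_graph H"
  shows "pair_graph (graph_union G H)"
proof -
  interpret G: pair_graph G by fact
  interpret H: pair_graph H by fact
  have "parcs (graph_union G H) \<subseteq> (pverts G <+> pverts H) \<times> (pverts G <+> pverts H)"
    by (auto simp: graph_union_def dest: G.in_arcsD1 G.in_arcsD2 H.in_arcsD1 H.in_arcsD2)
  then have "finite (parcs (graph_union G H))"
    by (rule finite_subset) auto
  moreover have "sym (parcs G)" "sym (parcs H)"
    using G.sym_arcs H.sym_arcs by (simp_all add: symmetric_def)
  then have "symmetric (with_proj (graph_union G H))"
    by (simp add: graph_union_def symmetric_def) (auto simp: sym_def)
  moreover have "fst a \<in> pverts (graph_union G H) \<and> snd a \<in> pverts (graph_union G H) \<and> fst a \<noteq> snd a"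
    if "a \<in> parcs (graph_union G H)" for a
    using that
    by (auto simp: graph_union_def
        dest: G.in_arcsD1 G.in_arcsD2 H.in_arcsD1 H.in_arcsD2 G.no_loops' H.no_loops')
  moreover have "finite (pverts (graph_union G H))"
    by (simp add: graph_union_def)
  ultimately show ?thesis
    by unfold_locales simp_all
qed

lemma pair_graph_graph_copies:
  assumes "pair_graph G"
  shows "pair_graph (graph_copies r G)"
proof -
  interpret G: pair_graph G by fact
  have "parcs (graph_copies r G) \<subseteq> ({..<r} \<times> pverts G) \<times> ({..<r} \<times> pverts G)"
    by (auto simp: graph_copies_def dest: G.in_arcsD1 G.in_arcsD2)
  then have "finite (parcs (graph_copies r G))"
    by (rule finite_subset) auto
  moreover have "sym (parcs G)"
    using G.sym_arcs by (simp add: symmetric_def)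
  then have "symmetric (with_proj (graph_copies r G))"
    by (simp add: graph_copies_def symmetric_def) (auto simp: sym_def)
  ultimately show ?thesis
    by unfold_locales
      (auto simp: graph_copies_def dest: G.in_arcsD1 G.in_arcsD2 G.no_loops')
qed

text \<open>
  On simple graphs, \<^const>\<open>digraph_iso\<close> is the usual notion: a bijection between the vertex sets
  that preserves and reflects adjacency.
\<close>

lemma graph_isomorphic_iff:
  assumes "pair_graph G" "pair_graph H"
  shows "graph_isomorphic G H \<longleftrightarrow>
    (\<exists>f. bij_betw f (pverts G) (pverts H) \<and>
      (\<forall>u\<in>pverts G. \<forall>v\<in>pverts G. (u, v) \<in> parcs G \<longleftrightarrow> (f u, f v) \<in> parcs H))"
    (is "?L \<longleftrightarrow> ?R")
proof -
  interpret G: pair_graph G by fact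
  interpret H: pair_graph H by fact
  show ?thesis
  proof
    assume ?L
    then obtain h where inj: "inj_on (iso_verts h) (pverts G)"
      and ends: "\<And>a. a \<in> parcs G \<Longrightarrow> iso_verts h (fst a) = iso_tail h (iso_arcs h a)
                    \<and> iso_verts h (snd a) = iso_head h (iso_arcs h a)"
      and H: "with_proj H = app_iso h (with_proj G)"
      by (auto simp: graph_isomorphic_def digraph_iso_def pre_digraph.digraph_isomorphism_def)
    have pv: "pverts H = iso_verts h ` pverts G" and pa: "parcs H = iso_arcs h ` parcs G"
      and t: "iso_tail h = fst" and hd: "iso_head h = snd"
      using arg_cong[OF H, of verts] arg_cong[OF H, of arcs]
        arg_cong[OF H, of tail] arg_cong[OF H, of head] by simp_all
    have "iso_arcs h a = map_prod (iso_verts h) (iso_verts h) a" if "a \<in> parcs G" for a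
      using ends[OF that] by (simp add: t hd prod_eq_iff)
    then have pa': "parcs H = map_prod (iso_verts h) (iso_verts h) ` parcs G"
      unfolding pa by (rule image_cong[OF refl])
    have "(u, v) \<in> parcs G \<longleftrightarrow> (iso_verts h u, iso_verts h v) \<in> parcs H"
      if "u \<in> pverts G" "v \<in> pverts G" for u v
    proof
      assume "(u, v) \<in> parcs G"
      then show "(iso_verts h u, iso_verts h v) \<in> parcs H"
        unfolding pa' by force
    next
      assume "(iso_verts h u, iso_verts h v) \<in> parcs H"
      then obtain u' v' where uv: "(u', v') \<in> parcs G"
          "iso_verts h u' = iso_verts h u" "iso_verts h v' = iso_verts h v"
        unfolding pa' by auto
      then have "u' = u" "v' = v"
        using that inj_onD[OF inj] G.in_arcsD1[OF uv(1)] G.in_arcsD2[OF uv(1)] by blast+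
      then show "(u, v) \<in> parcs G"
        using uv by simp
    qed
    then show ?R
      using inj pv by (auto simp: bij_betw_def intro!: exI[of _ "iso_verts h"])
  next
    assume ?R
    then obtain f where bij: "bij_betw f (pverts G) (pverts H)"
      and adj: "\<And>u v. u \<in> pverts G \<Longrightarrow> v \<in> pverts G \<Longrightarrow> (u, v) \<in> parcs G \<longleftrightarrow> (f u, f v) \<in> parcs H"
      by blast
    have inj: "inj_on f (pverts G)" and im: "pverts H = f ` pverts G"
      using bij by (auto simp: bij_betw_def)
    let ?h = "\<lparr>iso_verts = f, iso_arcs = map_prod f f, iso_head = snd, iso_tail = fst\<rparr>"
    have "inj_on (map_prod f f) (parcs G)"
    proof (rule inj_on_subset)
      show "inj_on (map_prod f f) (pverts G \<times> pverts G)"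
        using inj by (rule map_prod_inj_on[OF _ inj])
      show "parcs G \<subseteq> pverts G \<times> pverts G"
        using G.in_arcsD1 G.in_arcsD2 by auto
    qed
    then have "pre_digraph.digraph_isomorphism (with_proj G) ?h"
      using inj G.wf_digraph by (simp add: pre_digraph.digraph_isomorphism_def)
    moreover have "parcs H = map_prod f f ` parcs G"
    proof (intro equalityI subsetI)
      fix a assume a: "a \<in> parcs H"
      obtain x y where xy: "a = (x, y)"
        by (cases a)
      then have "x \<in> f ` pverts G" "y \<in> f ` pverts G"
        using a H.in_arcsD1 H.in_arcsD2 unfolding im by blast+
      then obtain u v where uv: "x = f u" "y = f v" "u \<in> pverts G" "v \<in> pverts G"
        by blast
      then have "(u, v) \<in> parcs G"
        using a xy adj[of u v] by simp
      then show "a \<in> map_prod f f ` parcs G"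
        unfolding xy uv(1,2) by (rule map_prod_imageI)
    next
      fix a assume "a \<in> map_prod f f ` parcs G"
      then obtain u v where uv: "(u, v) \<in> parcs G" and a: "a = (f u, f v)"
        by auto
      then show "a \<in> parcs H"
        using adj[OF G.in_arcsD1[OF uv] G.in_arcsD2[OF uv]] by simp
    qed
    then have "with_proj H = app_iso ?h (with_proj G)"
      by (simp add: app_iso_def with_proj_def im)
    ultimately show ?L
      unfolding graph_isomorphic_def digraph_iso_def by blast
  qed
qed

end

theory Submission
  imports Defs
begin

text \<open>
  The ring of integers modulo a prime power has no idempotents besides \<open>0\<close> and \<open>1\<close>: if \<open>p ^ n\<close>
  divides \<open>e (e - 1)\<close>, it divides one of these two coprime factors. Hence every vertex of the graph
  has the form \<open>(1, u)\<close>, the condition on the product of the idempotents never applies, and \<open>(1, u)\<close>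
  is adjacent to \<open>(1, v)\<close> exactly if \<open>v\<close> is the inverse of \<open>u\<close> and \<open>u \<noteq> v\<close>
  (\<open>clean_graph2_trivial_idempotents\<close>). So the graph only records the involution \<open>u \<mapsto> inv u\<close> on the
  unit group: a unit that is its own inverse is an isolated vertex, and any other unit forms a
  copy of \<open>K\<^sub>2\<close> with its inverse (\<open>graph_of_involution\<close>).

  It remains to count. The number of units is Euler's totient, and the self-inverse units are the
  solutions of \<open>x\<^sup>2 \<equiv> 1\<close>, where \<open>p ^ n\<close> divides \<open>(x - 1) (x + 1)\<close>. For odd \<open>p\<close> only
  one of the factors can be a multiple of \<open>p\<close>, which leaves \<open>x \<equiv> \<plusminus>1\<close>. For \<open>p = 2\<close> both factors are
  even and their halves are consecutive integers, so \<open>2 ^ (n - 1)\<close> divides one factor; this gives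
  four solutions once \<open>n \<ge> 3\<close>. Modulo \<open>2\<close> and \<open>4\<close> every unit is its own inverse and the graph
  has no edges.
\<close>

section \<open>Graphs in which every vertex has at most one neighbour\<close>

lemma graph_isomorphic_arcless:
  assumes "pair_graph G" "pair_graph H"
    and "parcs G = {}" "parcs H = {}" and "card (pverts G) = card (pverts H)"
  shows "graph_isomorphic G H"
proof -
  interpret G: pair_graph G by fact
  interpret H: pair_graph H by fact
  obtain f where "bij_betw f (pverts G) (pverts H)"
    using finite_same_card_bij[OF G.finite_verts H.finite_verts] assms(5) by auto
  then show ?thesis
    unfolding graph_isomorphic_iff[OF assms(1,2)] using assms(3,4) by auto
qed

text \<open>
  The edges are the orbits of size two of the involution. An arbitrary enumeration of the vertices
  singles out the endpoint of smaller rank in each of them, so that these endpoints index the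
  copies of \<open>K\<^sub>2\<close>, while the fixed points index the copies of \<open>K\<^sub>1\<close>.
\<close>

lemma graph_of_involution:
  assumes G: "pair_graph G"
    and closed: "\<And>x. x \<in> pverts G \<Longrightarrow> g x \<in> pverts G"
    and invol: "\<And>x. x \<in> pverts G \<Longrightarrow> g (g x) = x"
    and adj: "\<And>x y. x \<in> pverts G \<Longrightarrow> y \<in> pverts G \<Longrightarrow> (x, y) \<in> parcs G \<longleftrightarrow> x \<noteq> y \<and> y = g x"
    and fixed: "card {x \<in> pverts G. g x = x} = s"
    and total: "card (pverts G) = s + 2 * k"
  shows "graph_isomorphic G
    (graph_union (graph_copies s (complete_graph 1)) (graph_copies k (complete_graph 2)))"
    (is "graph_isomorphic G ?H")
proof -
  interpret G: pair_graph G by fact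
  let ?V = "pverts G"
  obtain r :: "'a \<Rightarrow> nat" where r: "inj_on r ?V"
    using finite_imp_inj_to_nat_seg[OF G.finite_verts] by blast
  define F where "F = {x \<in> ?V. g x = x}"
  define A where "A = {x \<in> ?V. r x < r (g x)}"
  define B where "B = {x \<in> ?V. r (g x) < r x}"
  have fin: "finite F" "finite A" "finite B"
    using G.finite_verts by (auto simp: F_def A_def B_def)
  have r_eq: "r (g x) = r x \<longleftrightarrow> g x = x" if "x \<in> ?V" for x
    using inj_on_eq_iff[OF r] closed that by auto
  have V: "?V = F \<union> (A \<union> B)"
    using r_eq by (force simp: F_def A_def B_def)
  have gAB: "bij_betw g A B"
    by (rule bij_betw_byWitness[where f' = g]) (auto simp: A_def B_def closed invol)
  have "card ?V = card F + (card A + card B)"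
    unfolding V using fin
    by (subst card_Un_disjoint card_Un_disjoint[of A B]; auto simp: F_def A_def B_def)+
  then have cards: "card F = s" "card A = k"
    using total fixed bij_betw_same_card[OF gAB] by (auto simp: F_def)
  obtain h where h: "bij_betw h F {0..<s}"
    using ex_bij_betw_finite_nat[OF fin(1)] cards by auto
  obtain h' where h': "bij_betw h' A {0..<k}"
    using ex_bij_betw_finite_nat[OF fin(2)] cards by auto
  \<comment> \<open>In the copy of \<open>K\<^sub>2\<close> with number \<open>h' x\<close>, the endpoint \<open>x \<in> A\<close> is vertex \<open>0\<close> and \<open>g x\<close> is
    vertex \<open>1\<close>.\<close>
  define f where "f x = (if x \<in> F then Inl (h x, 0::nat)
      else if x \<in> A then Inr (h' x, 0::nat) else Inr (h' (g x), 1))" for x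
  define f' where "f' z = (case z of Inl (i, j) \<Rightarrow> inv_into F h i
      | Inr (i, j) \<Rightarrow> (if j = 0 then inv_into A h' i else g (inv_into A h' i)))"
    for z :: "nat \<times> nat + nat \<times> nat"
  have inv_h: "inv_into F h i \<in> F" "h (inv_into F h i) = i" if "i < s" for i
    using bij_betw_inv_into_right[OF h] bij_betwE[OF bij_betw_inv_into[OF h]] that by auto
  have inv_h': "inv_into A h' i \<in> A" "h' (inv_into A h' i) = i" if "i < k" for i
    using bij_betw_inv_into_right[OF h'] bij_betwE[OF bij_betw_inv_into[OF h']] that by auto
  have hF: "h x < s" if "x \<in> F" for x
    using bij_betwE[OF h] that by auto
  have hA: "h' x < k" if "x \<in> A" for x
    using bij_betwE[OF h'] that by auto
  have gB: "g x \<in> A" if "x \<in> ?V" "x \<notin> F" "x \<notin> A" for x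
  proof -
    have "x \<in> B" using that V by blast
    then show ?thesis by (simp add: A_def B_def closed invol)
  qed
  have gA: "g x \<notin> A" "g x \<notin> F" if "x \<in> A" for x
    using that by (auto simp: A_def F_def closed invol)
  have AV: "x \<in> ?V" "x \<notin> F" if "x \<in> A" for x
    using that by (auto simp: A_def F_def)
  have FA: "x \<notin> A" if "x \<in> F" for x
    using that by (auto simp: A_def F_def)
  define H where "H = ?H"
  have vH: "pverts H = ({..<s} \<times> {0}) <+> ({..<k} \<times> {0, 1})"
    by (auto simp: H_def graph_union_def graph_copies_def complete_graph_def)
  have bij: "bij_betw f ?V (pverts H)"
  proof (rule bij_betw_byWitness[where f' = f'])
    show "\<forall>x\<in>?V. f' (f x) = x"
      using bij_betw_inv_into_left[OF h] bij_betw_inv_into_left[OF h'] gB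
      by (auto simp: f_def f'_def invol)
    show "\<forall>z\<in>pverts H. f (f' z) = z"
      unfolding vH using inv_h inv_h' gA AV FA by (auto simp: f_def f'_def invol)
    show "f ` ?V \<subseteq> pverts H"
      unfolding vH using hF hA gB by (auto simp: f_def)
    show "f' ` pverts H \<subseteq> ?V"
      unfolding vH using inv_h inv_h' AV closed by (auto simp: f'_def F_def)
  qed
  have adjH: "(z, w) \<in> parcs H \<longleftrightarrow>
      (\<exists>i<k. (z, w) = (Inr (i, 0), Inr (i, 1)) \<or> (z, w) = (Inr (i, 1), Inr (i, 0)))" for z w
    by (auto simp: H_def graph_union_def graph_copies_def complete_graph_def less_2_cases_iff)
  have inj': "h' x = h' y \<longleftrightarrow> x = y" if "x \<in> A" "y \<in> A" for x y
    using that h' by (auto simp: bij_betw_def inj_on_eq_iff)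
  have "(x, y) \<in> parcs G \<longleftrightarrow> (f x, f y) \<in> parcs H" if x: "x \<in> ?V" and y: "y \<in> ?V" for x y
  proof -
    consider "x \<in> F" | "x \<in> A" | "x \<notin> F" "x \<notin> A" by blast
    then show ?thesis
    proof cases
      case 1
      then show ?thesis
        using adj[OF x y] by (auto simp: adjH f_def F_def)
    next
      case 2
      have "(f x, f y) \<in> parcs H \<longleftrightarrow> y \<notin> F \<and> y \<notin> A \<and> h' x = h' (g y)"
        using 2 AV[OF 2] hA by (auto simp: adjH f_def)
      also have "\<dots> \<longleftrightarrow> y = g x"
        using inj'[OF 2 gB[OF y]] gA[OF 2] invol[OF x] invol[OF y] by metis
      finally show ?thesis
        using adj[OF x y] 2 gA(1)[OF 2] by metis
    next
      case 3
      have "(f x, f y) \<in> parcs H \<longleftrightarrow> y \<in> A \<and> h' (g x) = h' y"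
        using 3 AV hA by (auto simp: adjH f_def)
      also have "\<dots> \<longleftrightarrow> y = g x"
        using inj'[OF gB[OF x 3]] gB[OF x 3] by metis
      finally show ?thesis
        using adj[OF x y] 3 gB[OF x 3] by auto
    qed
  qed
  moreover have "pair_graph H"
    unfolding H_def by (intro pair_graph_graph_union pair_graph_graph_copies pair_graph_complete_graph)
  ultimately show ?thesis
    unfolding H_def[symmetric] graph_isomorphic_iff[OF G \<open>pair_graph H\<close>] using bij by blast
qed

section \<open>The clean graph of a ring with trivial idempotents\<close>

text \<open>
  With \<open>1\<close> as the only nonzero idempotent, \<open>e f = 0\<close> is impossible on vertices, and only the
  adjacency of mutually inverse units remains.
\<close>

lemma (in ring) clean_graph2_trivial_idempotents:
  assumes "idempotents R = {\<zero>, \<one>}" "\<one> \<noteq> \<zero>"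
  shows "pverts (clean_graph2 R) = {\<one>} \<times> Units R"
    and "parcs (clean_graph2 R) = {((\<one>, u), (\<one>, inv u)) | u. u \<in> Units R \<and> inv u \<noteq> u}"
proof -
  have V: "(idempotents R - {\<zero>}) \<times> Units R = {\<one>} \<times> Units R"
    using assms by auto
  then show "pverts (clean_graph2 R) = {\<one>} \<times> Units R"
    by (simp add: clean_graph2_def)
  have inverse: "u \<otimes> v = \<one> \<and> v \<otimes> u = \<one> \<longleftrightarrow> v = inv u" if "u \<in> Units R" "v \<in> Units R" for u v
    using that by (metis Units_closed Units_l_inv Units_r_inv inv_unique')
  have "parcs (clean_graph2 R) = {((\<one>, u), (\<one>, v)) | u v. u \<in> Units R \<and> v \<in> Units R \<and>
      u \<noteq> v \<and> u \<otimes> v = \<one> \<and> v \<otimes> u = \<one>}"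
    unfolding clean_graph2_def Let_def V using assms(2) by auto
  also have "\<dots> = {((\<one>, u), (\<one>, v)) | u v. u \<in> Units R \<and> v \<in> Units R \<and> u \<noteq> v \<and> v = inv u}"
    using inverse by blast
  also have "\<dots> = {((\<one>, u), (\<one>, inv u)) | u. u \<in> Units R \<and> inv u \<noteq> u}"
    by (auto dest: Units_inv_Units)
  finally show "parcs (clean_graph2 R) = {((\<one>, u), (\<one>, inv u)) | u. u \<in> Units R \<and> inv u \<noteq> u}" .
qed

text \<open>
  The involution \<open>(1, u) \<mapsto> (1, inv u)\<close> fixes \<open>(1, u)\<close> exactly if \<open>u\<close> squares to \<open>1\<close>, so the
  isomorphism type depends only on two cardinalities of the unit group.
\<close>

lemma (in ring) clean_graph2_isomorphic_by_units:
  assumes fin: "finite (carrier R)"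
    and idem: "idempotents R = {\<zero>, \<one>}" "\<one> \<noteq> \<zero>"
    and s: "card {u \<in> Units R. u \<otimes> u = \<one>} = s" and k: "card (Units R) = s + 2 * k"
  shows "graph_isomorphic (clean_graph2 R)
    (graph_union (graph_copies s (complete_graph 1)) (graph_copies k (complete_graph 2)))"
proof (rule graph_of_involution[where g = "map_prod id (m_inv R)"])
  note G = clean_graph2_trivial_idempotents[OF idem]
  show "pair_graph (clean_graph2 R)"
    using fin by (rule pair_graph_clean_graph2)
  have "inv u = u \<longleftrightarrow> u \<otimes> u = \<one>" if "u \<in> Units R" for u
    using that by (metis Units_closed Units_r_inv inv_unique')
  then have "{x \<in> pverts (clean_graph2 R). map_prod id (m_inv R) x = x}
      = {\<one>} \<times> {u \<in> Units R. u \<otimes> u = \<one>}"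
    by (auto simp: G)
  then show "card {x \<in> pverts (clean_graph2 R). map_prod id (m_inv R) x = x} = s"
    using s by (simp add: card_cartesian_product_singleton)
  show "card (pverts (clean_graph2 R)) = s + 2 * k"
    using k by (simp add: G card_cartesian_product_singleton)
  fix x assume "x \<in> pverts (clean_graph2 R)"
  then obtain u where x: "x = (\<one>, u)" and u: "u \<in> Units R"
    unfolding G by blast
  show "map_prod id (m_inv R) x \<in> pverts (clean_graph2 R)"
    unfolding G x using u by simp
  show "map_prod id (m_inv R) (map_prod id (m_inv R) x) = x"
    unfolding x using u by simp
  fix y assume "y \<in> pverts (clean_graph2 R)"
  then obtain v where y: "y = (\<one>, v)"
    unfolding G by blast
  have "(x, y) \<in> parcs (clean_graph2 R) \<longleftrightarrow> inv u \<noteq> u \<and> v = inv u"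
    unfolding G x y using u by blast
  then show "(x, y) \<in> parcs (clean_graph2 R) \<longleftrightarrow> x \<noteq> y \<and> y = map_prod id (m_inv R) x"
    unfolding x y by fastforce
qed

section \<open>Units and idempotents modulo a prime power\<close>

text \<open>
  A prime cannot divide two consecutive integers, so a prime power dividing their product divides
  one of them.
\<close>

lemma prime_power_dvd_consecutive:
  fixes a p :: int
  assumes p: "prime p" and dvd: "p ^ n dvd a * (a + 1)"
  shows "p ^ n dvd a \<or> p ^ n dvd a + 1"
proof (cases "p dvd a")
  case True
  then have "\<not> p dvd a + 1"
    using p not_prime_unit[of p] dvd_add_right_iff[of p a 1] by blast
  then have "coprime (p ^ n) (a + 1)"
    using p by (simp add: prime_imp_coprime)
  then show ?thesis
    using dvd by (simp add: coprime_dvd_mult_left_iff)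
next
  case False
  then have "coprime (p ^ n) a"
    using p by (simp add: prime_imp_coprime)
  then show ?thesis
    using dvd by (simp add: coprime_dvd_mult_right_iff)
qed

lemma residues_prime_power:
  fixes p n :: nat
  assumes "prime p" "n \<ge> 1"
  shows "residues (int (p ^ n))"
proof
  have "1 < p ^ n"
    using prime_gt_1_nat[OF assms(1)] assms(2) by (intro one_less_power) auto
  then show "1 < int (p ^ n)"
    using of_nat_less_iff[of 1 "p ^ n", where 'a = int] by (simp only: of_nat_1)
qed

lemma idempotents_residue_ring_prime_power:
  fixes p n :: nat
  assumes p: "prime p" and n: "n \<ge> 1"
  shows "idempotents (residue_ring (int (p ^ n))) = {0, 1}"
proof -
  interpret residues "int (p ^ n)" "residue_ring (int (p ^ n))"
    using residues_prime_power[OF assms] .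
  have "e = 0 \<or> e = 1" if e: "0 \<le> e" "e < int (p ^ n)" "e * e mod int (p ^ n) = e" for e
  proof -
    have "int (p ^ n) dvd e * e - e"
      using e(3) by (metis mod_eq_dvd_iff mod_mod_trivial)
    then have "int p ^ n dvd (e - 1) * ((e - 1) + 1)"
      by (simp add: algebra_simps)
    then have "int (p ^ n) dvd e - 1 \<or> int (p ^ n) dvd e"
      using prime_power_dvd_consecutive[of "int p" n "e - 1"] p by simp
    then show ?thesis
    proof
      assume "int (p ^ n) dvd e - 1"
      then have "\<not> (0 < e - 1 \<and> e - 1 < int (p ^ n))"
        using zdvd_not_zless by blast
      then show ?thesis using e(1,2) by linarith
    next
      assume "int (p ^ n) dvd e"
      then have "\<not> (0 < e \<and> e < int (p ^ n))"
        using zdvd_not_zless by blast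
      then show ?thesis using e(1,2) by linarith
    qed
  qed
  then show ?thesis
    using m_gt_one prime_gt_0_nat[OF p]
    by (auto simp: idempotents_def res_carrier_eq res_mult_eq simp del: of_nat_power)
qed

lemma card_Units_residue_ring:
  assumes "m > 1"
  shows "card (Units (residue_ring (int m))) = totient m"
proof -
  interpret residues "int m" "residue_ring (int m)"
    using assms by unfold_locales simp
  have "Units (residue_ring (int m)) = int ` totatives m"
  proof (intro equalityI subsetI)
    fix x assume "x \<in> Units (residue_ring (int m))"
    then have "x = int (nat x)" "nat x \<in> totatives m"
      by (auto simp: res_units_eq totatives_def nat_le_iff simp flip: coprime_int_iff)
    then show "x \<in> int ` totatives m" by blast
  next
    fix x assume "x \<in> int ` totatives m"
    then show "x \<in> Units (residue_ring (int m))"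
      using assms totatives_less by (auto simp: res_units_eq in_totatives_iff)
  qed
  then show ?thesis
    by (simp add: totient_def card_image)
qed

text \<open>
  A solution of \<open>x\<^sup>2 \<equiv> 1\<close> is its own inverse, hence automatically a unit; so the units can be
  dropped from the count, which becomes a divisibility problem.
\<close>

lemma self_inverse_units_residue_ring:
  assumes "m > 1"
  shows "{u \<in> Units (residue_ring m). u \<otimes>\<^bsub>residue_ring m\<^esub> u = \<one>\<^bsub>residue_ring m\<^esub>}
    = {x. 0 \<le> x \<and> x < m \<and> m dvd (x - 1) * (x + 1)}"
proof -
  interpret residues m "residue_ring m"
    using assms by unfold_locales
  have sq: "x * x mod m = 1 \<longleftrightarrow> m dvd (x - 1) * (x + 1)" for x
    using assms mod_eq_dvd_iff[of "x * x" m 1] by (simp add: algebra_simps)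
  have "0 < x \<and> coprime x m" if "0 \<le> x" "x * x mod m = 1" for x
  proof
    show "0 < x" using that by (cases "x = 0") auto
    have "[x * x = 1] (mod m)"
      using that(2) assms by (simp add: cong_def)
    then show "coprime x m"
      using coprime_iff_invertible_int by blast
  qed
  then show ?thesis
    by (auto simp: res_units_eq res_mult_eq res_one_eq sq)
qed

text \<open>
  An odd prime cannot divide both \<open>x - 1\<close> and \<open>x + 1\<close>, whose difference is \<open>2\<close>, so the whole
  prime power divides one of them.
\<close>

lemma card_square_roots_of_one_odd_prime_power:
  fixes p n :: nat
  assumes p: "prime p" "p \<noteq> 2" and n: "n \<ge> 1"
  shows "card {x::int. 0 \<le> x \<and> x < int (p ^ n) \<and> int (p ^ n) dvd (x - 1) * (x + 1)} = 2"
proof -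
  define m where "m = int (p ^ n)"
  have "p > 2" using p prime_ge_2_nat[of p] by simp
  then have m2: "m > 2"
    unfolding m_def using n self_le_power[of p n] by linarith
  have "x = 1 \<or> x = m - 1" if x: "0 \<le> x" "x < m" "m dvd (x - 1) * (x + 1)" for x
  proof -
    have "m dvd x - 1 \<or> m dvd x + 1"
    proof (cases "int p dvd x - 1")
      case True
      have "\<not> int p dvd x + 1"
      proof
        assume "int p dvd x + 1"
        from dvd_diff[OF this True] have "int p dvd 2" by simp
        then show False using \<open>p > 2\<close> by (auto dest: zdvd_imp_le)
      qed
      then have "coprime m (x + 1)"
        unfolding m_def using p by (simp add: prime_imp_coprime)
      then show ?thesis
        using x(3) by (simp add: coprime_dvd_mult_left_iff)
    next
      case False
      then have "coprime m (x - 1)"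
        unfolding m_def using p by (simp add: prime_imp_coprime)
      then show ?thesis
        using x(3) by (simp add: coprime_dvd_mult_right_iff)
    qed
    then show ?thesis
    proof
      assume "m dvd x - 1"
      then show ?thesis
        using x m2 zdvd_not_zless[of "x - 1" m] by (cases "x = 0") (auto dest: zdvd_imp_le)
    next
      assume "m dvd x + 1"
      then show ?thesis using x zdvd_imp_le[of m "x + 1"] by simp
    qed
  qed
  then have "{x. 0 \<le> x \<and> x < m \<and> m dvd (x - 1) * (x + 1)} = {1, m - 1}"
    using m2 by auto
  then show ?thesis
    using m2 by (simp add: m_def)
qed

text \<open>
  Writing \<open>x = 2 y + 1\<close> turns \<open>(x - 1) (x + 1)\<close> into \<open>4 y (y + 1)\<close>, a product of consecutive
  integers. One factor of \<open>2\<close> is lost on the way back, so \<open>x\<close> is only determined up to sign modulo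
  half of \<open>2 ^ n\<close>: both residues \<open>\<plusminus>1\<close> have two lifts. The four lifts are distinct because half of
  \<open>2 ^ n\<close> exceeds \<open>2\<close>.
\<close>

lemma card_square_roots_of_one_power_of_2:
  fixes n :: nat
  assumes n: "n \<ge> 3"
  shows "card {x::int. 0 \<le> x \<and> x < int (2 ^ n) \<and> int (2 ^ n) dvd (x - 1) * (x + 1)} = 4"
proof -
  define h :: int where "h = 2 ^ (n - 1)"
  obtain k where k: "n = k + 3"
    using n by (metis add.commute le_Suc_ex)
  have m: "int (2 ^ n) = 2 * h" and h4: "h = 4 * 2 ^ k"
    by (simp_all add: h_def k power_add)
  have h: "h \<ge> 4" by (simp add: h4)
  have "x \<in> {1, h + 1, h - 1, 2 * h - 1}"
    if x: "0 \<le> x" "x < 2 * h" "2 * h dvd (x - 1) * (x + 1)" for x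
  proof -
    have "even ((x - 1) * (x + 1))"
      using x(3) by (rule dvd_mult_left)
    then obtain y where y: "x = 2 * y + 1"
      by (auto elim: oddE)
    have "2 * h = 4 * 2 ^ (k + 1)" "(x - 1) * (x + 1) = 4 * (y * (y + 1))"
      by (simp_all add: h4 y algebra_simps)
    then have "2 ^ (k + 1) dvd y * (y + 1)"
      using x(3) by (metis dvd_mult_cancel_left zero_neq_numeral)
    then have "2 ^ (k + 1) dvd y \<or> 2 ^ (k + 1) dvd y + 1"
      by (intro prime_power_dvd_consecutive) simp_all
    then have "2 * 2 ^ (k + 1) dvd 2 * y \<or> 2 * 2 ^ (k + 1) dvd 2 * (y + 1)"
      using mult_dvd_mono[OF dvd_refl] by blast
    then have "h dvd 2 * y \<or> h dvd 2 * (y + 1)"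
      by (simp only: h4) simp
    then obtain c where "2 * y = h * c \<or> 2 * (y + 1) = h * c"
      by (auto elim: dvdE)
    then have c: "x - 1 = h * c \<or> x + 1 = h * c"
      by (auto simp: y)
    \<comment> \<open>The range of \<open>x\<close> confines the multiple of \<open>h\<close> to \<open>0\<close>, \<open>h\<close> or \<open>2 * h\<close>.\<close>
    have "h * c > h * (-1)" "h * c < h * 3"
      using c x(1,2) h by (elim disjE; linarith)+
    then have "-1 < c" "c < 3"
      using h by (simp_all only: mult_less_cancel_left_pos)
    then consider "c = 0" | "c = 1" | "c = 2" by linarith
    then show ?thesis
      using c x h by cases auto
  qed
  moreover have "2 * h dvd (x - 1) * (x + 1)" if "x \<in> {1, h + 1, h - 1, 2 * h - 1}" for x
  proof -
    have "2 * h dvd h * (h + 2)" "2 * h dvd (h - 2) * h" "2 * h dvd (2 * h - 2) * (2 * h)"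
      by (simp_all add: h4 algebra_simps)
    then show ?thesis using that by auto
  qed
  ultimately have "{x. 0 \<le> x \<and> x < 2 * h \<and> 2 * h dvd (x - 1) * (x + 1)}
      = {1, h + 1, h - 1, 2 * h - 1}"
    using h by auto
  then show ?thesis
    unfolding m using h by simp
qed

section \<open>The clean graph modulo a prime power\<close>

text \<open>
  The product \<open>p ^ (n - 1) * (p - 1)\<close> is Euler's totient of \<open>p ^ n\<close>, the number of units; the
  \<open>s\<close> self-inverse ones are split off and the others come in \<open>k\<close> pairs.
\<close>

lemma clean_graph2_residue_ring_isomorphic:
  fixes p n s k :: nat
  assumes p: "prime p" and n: "n \<ge> 1"
    and s: "card {x::int. 0 \<le> x \<and> x < int (p ^ n) \<and> int (p ^ n) dvd (x - 1) * (x + 1)} = s"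
    and k: "p ^ (n - 1) * (p - 1) = s + 2 * k"
  shows "graph_isomorphic (clean_graph2 (residue_ring (int (p ^ n))))
    (graph_union (graph_copies s (complete_graph 1)) (graph_copies k (complete_graph 2)))"
proof -
  interpret residues "int (p ^ n)" "residue_ring (int (p ^ n))"
    using residues_prime_power[OF p n] .
  have m: "1 < p ^ n"
    using prime_gt_1_nat[OF p] n by (intro one_less_power) auto
  show ?thesis
  proof (rule clean_graph2_isomorphic_by_units)
    show "card (Units (residue_ring (int (p ^ n)))) = s + 2 * k"
      using card_Units_residue_ring[OF m] totient_prime_power[of p n] p n k by simp
  qed (use s m_gt_one self_inverse_units_residue_ring[of "int (p ^ n)"]
        idempotents_residue_ring_prime_power[OF p n] in
        \<open>simp_all add: res_zero_eq res_one_eq del: of_nat_power\<close>)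
qed

text \<open>
  If every unit is its own inverse, the graph has no edges. This covers the moduli \<open>2\<close> and \<open>4\<close>, and
  leaves the form of the target graph free, since any two edgeless graphs of equal size are
  isomorphic.
\<close>

lemma clean_graph2_residue_ring_arcless:
  fixes p n :: nat
  assumes p: "prime p" and n: "n \<ge> 1"
    and involutions: "\<And>u. u \<in> Units (residue_ring (int (p ^ n))) \<Longrightarrow> u * u mod int (p ^ n) = 1"
    and H: "pair_graph H" "parcs H = {}" "card (pverts H) = p ^ (n - 1) * (p - 1)"
  shows "graph_isomorphic (clean_graph2 (residue_ring (int (p ^ n)))) H"
proof -
  let ?R = "residue_ring (int (p ^ n))"
  interpret residues "int (p ^ n)" ?R
    using residues_prime_power[OF p n] .
  have m: "1 < p ^ n"
    using prime_gt_1_nat[OF p] n by (intro one_less_power) auto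
  have "idempotents ?R = {\<zero>\<^bsub>?R\<^esub>, \<one>\<^bsub>?R\<^esub>}" "\<one>\<^bsub>?R\<^esub> \<noteq> \<zero>\<^bsub>?R\<^esub>"
    using idempotents_residue_ring_prime_power[OF p n]
    by (simp_all add: res_zero_eq res_one_eq del: of_nat_power)
  note G = clean_graph2_trivial_idempotents[OF this]
  have "m_inv ?R u = u" if "u \<in> Units ?R" for u
    using involutions[OF that] that
    by (metis inv_unique' Units_closed res_mult_eq res_one_eq)
  then have "parcs (clean_graph2 ?R) = {}"
    unfolding G by blast
  moreover have "card (pverts (clean_graph2 ?R)) = card (pverts H)"
    using card_Units_residue_ring[OF m] totient_prime_power[of p n] p n H(3)
    unfolding G by (simp add: card_cartesian_product_singleton)
  ultimately show ?thesis
    using H pair_graph_clean_graph2[OF finite] by (intro graph_isomorphic_arcless)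
qed

theorem theorem2:
  fixes p n :: nat
  assumes "prime p" and "n \<ge> 1"
  shows "(p = 2 \<and> n = 1 \<longrightarrow>
            graph_isomorphic (clean_graph2 (residue_ring (int (p ^ n)))) (complete_graph 1))
       \<and> (p = 2 \<and> n = 2 \<longrightarrow>
            graph_isomorphic (clean_graph2 (residue_ring (int (p ^ n))))
              (graph_copies 2 (complete_graph 1)))
       \<and> (p = 2 \<and> n \<ge> 3 \<longrightarrow>
            graph_isomorphic (clean_graph2 (residue_ring (int (p ^ n))))
              (graph_union (graph_copies 4 (complete_graph 1))
                 (graph_copies (2 ^ (n - 1) - 2 ^ (n - 2) - 2) (complete_graph 2))))
       \<and> (p \<noteq> 2 \<longrightarrow>
            graph_isomorphic (clean_graph2 (residue_ring (int (p ^ n))))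
              (graph_union (graph_copies 2 (complete_graph 1))
                 (graph_copies ((p ^ n - p ^ (n - 1)) div 2 - 1) (complete_graph 2))))"
proof (intro conjI impI)
  assume a: "p = 2 \<and> n = 1"
  show "graph_isomorphic (clean_graph2 (residue_ring (int (p ^ n)))) (complete_graph 1)"
  proof (rule clean_graph2_residue_ring_arcless[OF assms _ pair_graph_complete_graph])
    fix u assume "u \<in> Units (residue_ring (int (p ^ n)))"
    then have "u \<in> {0..1}" "u \<noteq> 0"
      using a by (auto simp: Units_def residue_ring_def)
    then have "u = 1" by auto
    then show "u * u mod int (p ^ n) = 1" using a by simp
  qed (use a in \<open>auto simp: complete_graph_def\<close>)
next
  assume a: "p = 2 \<and> n = 2"
  interpret residues "int (p ^ n)" "residue_ring (int (p ^ n))"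
    using a by unfold_locales simp
  show "graph_isomorphic (clean_graph2 (residue_ring (int (p ^ n)))) (graph_copies 2 (complete_graph 1))"
  proof (rule clean_graph2_residue_ring_arcless[OF assms])
    fix u assume "u \<in> Units (residue_ring (int (p ^ n)))"
    then have u: "0 < u" "u < 4" "coprime u 4"
      unfolding res_units_eq using a by auto
    then have "u \<noteq> 2"
      by auto
    then have "u = 1 \<or> u = 3" using u by linarith
    then show "u * u mod int (p ^ n) = 1" using a by auto
  next
    show "pair_graph (graph_copies 2 (complete_graph 1))"
      by (intro pair_graph_graph_copies pair_graph_complete_graph)
  qed (use a in \<open>auto simp: complete_graph_def graph_copies_def\<close>)
next
  assume a: "p = 2 \<and> n \<ge> 3"
  then obtain k where k: "n = k + 3"
    by (metis add.commute le_Suc_ex)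
  obtain j where "(2::nat) ^ k = Suc j"
    using not0_implies_Suc[of "2 ^ k"] by auto
  then have "p ^ (n - 1) * (p - 1) = 4 + 2 * (2 ^ (n - 1) - 2 ^ (n - 2) - 2)"
    using a by (simp add: k)
  then show "graph_isomorphic (clean_graph2 (residue_ring (int (p ^ n))))
      (graph_union (graph_copies 4 (complete_graph 1))
        (graph_copies (2 ^ (n - 1) - 2 ^ (n - 2) - 2) (complete_graph 2)))"
    using card_square_roots_of_one_power_of_2[of n] a
    by (intro clean_graph2_residue_ring_isomorphic assms) simp_all
next
  assume a: "p \<noteq> 2"
  obtain q where q: "p = 2 * q + 1"
    using prime_odd_nat[OF assms(1)] prime_ge_2_nat[OF assms(1)] a by (auto elim!: oddE)
  obtain l where l: "n = Suc l"
    using assms(2) by (cases n) auto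
  have diff: "p ^ n - p ^ (n - 1) = 2 * (q * p ^ l)"
    by (simp add: l q algebra_simps)
  have units: "p ^ (n - 1) * (p - 1) = 2 * (q * p ^ l)"
    by (simp add: l q)
  have "q * p ^ l > 0"
    using prime_gt_1_nat[OF assms(1)] q by auto
  then obtain j where j: "q * p ^ l = Suc j"
    using gr0_implies_Suc by blast
  have "p ^ (n - 1) * (p - 1) = 2 + 2 * ((p ^ n - p ^ (n - 1)) div 2 - 1)"
    unfolding units diff j by simp
  then show "graph_isomorphic (clean_graph2 (residue_ring (int (p ^ n))))
      (graph_union (graph_copies 2 (complete_graph 1))
        (graph_copies ((p ^ n - p ^ (n - 1)) div 2 - 1) (complete_graph 2)))"
    using card_square_roots_of_one_odd_prime_power[OF assms(1) a assms(2)]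
    by (intro clean_graph2_residue_ring_isomorphic assms)
qed

end
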